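(* For every $k\ge1$, $\beta_k\le\gamma_k\le\alpha_k\le1$.
   Context: For a measurable $S\subset\mathbb R$ with non-empty interior and $x>0$, let $\tau(S,x)=\min\{|T|:T\subset\mathbb R,\ T+S\supseteq[0,x]\}$; the limit $\tau(S,\mathbb R)=\lim_{x\to\infty}\tau(S,x)/x$ exists, and $e(S,\mathbb R)=1/(\tau(S,\mathbb R)\lambda(S))$ where $\lambda$ is Lebesgue measure. For finite non-empty $S\subset\mathbb Z$, $\tau(S,n)=\min\{|T|:T\subseteq\mathbb Z,\ T+S\supseteq\{1,\dots,n\}\}$, $\tau(S,\mathbb Z)=\lim_{n\to\infty}\tau(S,n)/n$ and $e(S,\mathbb Z)=1/(\tau(S,\mathbb Z)|S|)$. Define $\alpha_k=\inf\{e(S,\mathbb Z):S\subset\mathbb Z,\ |S|=k\}$, $\beta_k=\inf\{e(\bigcup_{i=1}^kI_i,\mathbb R)\}$ over all choices of $k$ bounded intervals $I_1,\dots,I_k\subset\mathbb R$ of positive length, and $\gamma_k$ the same infimum restricted to intervals all of the same length. *)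

theory Defs
  imports "HOL-Analysis.Analysis"
begin

text \<open>In all sums of sets, \<open>T + S\<close> is the Minkowski sum from \<open>Set_Algebras\<close>. The minimum of
  \<open>|T|\<close> is taken over the finite \<open>T\<close>, since \<open>card\<close> is \<open>0\<close> on infinite sets; some finite \<open>T\<close>
  exists whenever \<open>S\<close> has non-empty interior (respectively, is non-empty).\<close>

definition tau_real :: "real set \<Rightarrow> real \<Rightarrow> nat" where
  "tau_real S x = (LEAST n. \<exists>T. finite T \<and> card T = n \<and> {0..x} \<subseteq> T + S)"

definition tau_R :: "real set \<Rightarrow> real" where
  "tau_R S = Lim at_top (\<lambda>x. real (tau_real S x) / x)"

definition e_R :: "real set \<Rightarrow> real" where
  "e_R S = 1 / (tau_R S * measure lebesgue S)"

definition tau_int :: "int set \<Rightarrow> nat \<Rightarrow> nat" where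
  "tau_int S n = (LEAST m. \<exists>T. finite T \<and> card T = m \<and> {1..int n} \<subseteq> T + S)"

definition tau_Z :: "int set \<Rightarrow> real" where
  "tau_Z S = lim (\<lambda>n. real (tau_int S n) / real n)"

definition e_Z :: "int set \<Rightarrow> real" where
  "e_Z S = 1 / (tau_Z S * real (card S))"

definition alpha :: "nat \<Rightarrow> real" where
  "alpha k = Inf {e_Z S | S. finite S \<and> card S = k}"

text \<open>Intervals may be open, closed or half-open, and may overlap.\<close>

definition bounded_pos_interval :: "real set \<Rightarrow> bool" where
  "bounded_pos_interval I \<longleftrightarrow> is_interval I \<and> bounded I \<and> measure lebesgue I > 0"

definition beta :: "nat \<Rightarrow> real" where
  "beta k = Inf {e_R (\<Union>i\<in>{1..k}. I i) | I. \<forall>i\<in>{1..k}. bounded_pos_interval (I i)}"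

definition gamma :: "nat \<Rightarrow> real" where
  "gamma k = Inf {e_R (\<Union>i\<in>{1..k}. I i) | I.
     (\<forall>i\<in>{1..k}. bounded_pos_interval (I i)) \<and>
     (\<forall>i\<in>{1..k}. \<forall>j\<in>{1..k}. measure lebesgue (I i) = measure lebesgue (I j))}"

end

theory Submission
  imports Defs
begin

text \<open>The half-open unit intervals with left end in a set \<open>S\<close> of integers form a set
  \<open>S + [0,1)\<close> with the same efficiency as \<open>S\<close>. Indeed, real translations covering
  \<open>A + [0,1)\<close> by \<open>S + [0,1)\<close> can be rounded up to integer translations covering \<open>A\<close> by \<open>S\<close>, so
  both covering numbers agree. Since \<open>S + [0,1)\<close> is a union of \<open>|S|\<close> intervals of length 1,
  this gives \<open>\<gamma>\<^sub>k \<le> \<alpha>\<^sub>k\<close>. The limits exist by Fekete's argument for monotone subadditive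
  functions. Efficiencies are at most 1 since \<open>|T|\<close> translates of \<open>S\<close> cover at
  most \<open>|T| |S|\<close> integers.\<close>

subsection \<open>Monotone subadditive functions\<close>

locale mono_subadditive =
  fixes f :: "real \<Rightarrow> real"
  assumes mono: "0 \<le> x \<Longrightarrow> x \<le> y \<Longrightarrow> f x \<le> f y"
    and subadditive: "0 \<le> x \<Longrightarrow> 0 \<le> y \<Longrightarrow> f (x + y) \<le> f x + f y"
begin

lemma nonneg:
  assumes "0 \<le> x"
  shows "0 \<le> f x"
  using mono[of 0 x] subadditive[of 0 0] assms by simp

lemma multiple_le:
  assumes "0 \<le> a"
  shows "f (real (Suc n) * a) \<le> real (Suc n) * f a"
proof (induction n)
  case (Suc n)
  have "f (real (Suc n) * a + a) \<le> f (real (Suc n) * a) + f a"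
    using assms by (intro subadditive) auto
  with Suc.IH show ?case by (simp add: algebra_simps)
qed simp

lemma quotient_le:
  assumes "0 < a" "0 < x"
  shows "f x / x \<le> f a / a + f a / x"
proof -
  define n where "n = nat \<lfloor>x / a\<rfloor>"
  have n: "real n \<le> x / a" "x / a \<le> real (Suc n)"
    using assms by (auto simp: n_def) linarith+
  have "f x \<le> f (real (Suc n) * a)"
    using n(2) assms by (intro mono) (auto simp: field_simps)
  also have "\<dots> \<le> real (Suc n) * f a"
    using assms by (intro multiple_le) simp
  also have "\<dots> \<le> (x / a + 1) * f a"
    using n(1) nonneg assms by (intro mult_right_mono) auto
  finally show ?thesis using assms by (simp add: field_simps)
qed

lemma quotient_tendsto_INF: "((\<lambda>x. f x / x) \<longlongrightarrow> (INF a\<in>{0<..}. f a / a)) at_top"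
proof -
  have bdd: "bdd_below ((\<lambda>a. f a / a) ` {0<..})"
    by (rule bdd_belowI[of _ 0]) (auto simp: nonneg)
  show ?thesis
  proof (rule order_tendstoI)
    fix b assume "b < (INF a\<in>{0<..}. f a / a)"
    then have "b < f x / x" if "0 < x" for x
      using cINF_lower[OF bdd, of x] that by auto
    then show "\<forall>\<^sub>F x in at_top. b < f x / x"
      by (rule eventually_mono[OF eventually_gt_at_top])
  next
    fix b assume "(INF a\<in>{0<..}. f a / a) < b"
    then obtain a where a: "0 < a" "f a / a < b"
      using cINF_less_iff[OF _ bdd] by auto
    have "((\<lambda>x. f a / a + f a / x) \<longlongrightarrow> f a / a + 0) at_top"
      by (intro tendsto_add tendsto_const tendsto_divide_0[OF tendsto_const]
          filterlim_at_top_imp_at_infinity filterlim_ident)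
    then have "\<forall>\<^sub>F x in at_top. f a / a + f a / x < b"
      by (rule order_tendstoD) (use a(2) in simp)
    then show "\<forall>\<^sub>F x in at_top. f x / x < b"
      using eventually_gt_at_top[of 0]
      by eventually_elim (use quotient_le[OF a(1)] in force)
  qed
qed

end

subsection \<open>Covering numbers\<close>

definition finitely_covers :: "'a::plus set \<Rightarrow> 'a set \<Rightarrow> bool" where
  "finitely_covers S A \<longleftrightarrow> (\<exists>T. finite T \<and> A \<subseteq> T + S)"

definition covering_number :: "'a::plus set \<Rightarrow> 'a set \<Rightarrow> nat" where
  "covering_number S A = (LEAST n. \<exists>T. finite T \<and> card T = n \<and> A \<subseteq> T + S)"

lemma tau_real_eq_covering_number: "tau_real S x = covering_number S {0..x}"
  by (simp add: tau_real_def covering_number_def)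

lemma tau_int_eq_covering_number: "tau_int S n = covering_number S {1..int n}"
  by (simp add: tau_int_def covering_number_def)

lemma covering_number_le:
  assumes "finite T" "A \<subseteq> T + S"
  shows "covering_number S A \<le> card T"
  unfolding covering_number_def by (rule Least_le) (use assms in blast)

lemma covering_number_attained:
  assumes "finitely_covers S A"
  obtains T where "finite T" "card T = covering_number S A" "A \<subseteq> T + S"
proof -
  have "\<exists>n T. finite T \<and> card T = n \<and> A \<subseteq> T + S"
    using assms by (auto simp: finitely_covers_def)
  from LeastI_ex[OF this] show thesis
    using that by (auto simp flip: covering_number_def)
qed

lemma covering_number_le_if_image_covers:
  assumes "finitely_covers S A" "\<And>T. A \<subseteq> T + S \<Longrightarrow> B \<subseteq> f ` T + S'"
  shows "covering_number S' B \<le> covering_number S A"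
proof -
  obtain T where T: "finite T" "card T = covering_number S A" "A \<subseteq> T + S"
    using covering_number_attained[OF assms(1)] .
  have "covering_number S' B \<le> card (f ` T)"
    using T assms(2) by (intro covering_number_le) auto
  also have "\<dots> \<le> card T"
    using T(1) by (rule card_image_le)
  finally show ?thesis using T(2) by simp
qed

lemma covering_number_mono:
  assumes "finitely_covers S B" "A \<subseteq> B"
  shows "covering_number S A \<le> covering_number S B"
  by (rule covering_number_le_if_image_covers[where f = id, OF assms(1)]) (use assms(2) in auto)

lemma covering_number_translate_le:
  fixes S :: "'a::semigroup_add set"
  assumes "finitely_covers S A"
  shows "covering_number S (c +o A) \<le> covering_number S A"
proof (rule covering_number_le_if_image_covers[OF assms])
  fix T assume "A \<subseteq> T + S"
  then have "c +o A \<subseteq> (c +o T) + S"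
    unfolding set_plus_rearrange3 by (rule set_plus_mono)
  also have "c +o T = (+) c ` T"
    by (auto simp: elt_set_plus_def)
  finally show "c +o A \<subseteq> (+) c ` T + S" .
qed

lemma finitely_covers_translate:
  fixes S :: "'a::semigroup_add set"
  assumes "finitely_covers S A"
  shows "finitely_covers S (c +o A)"
proof -
  obtain T where "finite T" "A \<subseteq> T + S"
    using assms by (auto simp: finitely_covers_def)
  then have "finite (c +o T)" "c +o A \<subseteq> (c +o T) + S"
    unfolding set_plus_rearrange3
    by (auto simp: elt_set_plus_def)
  then show ?thesis by (auto simp: finitely_covers_def)
qed

lemma covering_number_translate:
  fixes S :: "'a::ab_group_add set"
  assumes "finitely_covers S A"
  shows "covering_number S (c +o A) = covering_number S A"
proof (rule antisym)
  have "covering_number S (- c +o (c +o A)) \<le> covering_number S (c +o A)"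
    using assms by (intro covering_number_translate_le finitely_covers_translate)
  then show "covering_number S A \<le> covering_number S (c +o A)"
    by (simp add: set_plus_rearrange2)
qed (rule covering_number_translate_le[OF assms])

lemma covering_number_Un_le:
  assumes "finitely_covers S A" "finitely_covers S B"
  shows "covering_number S (A \<union> B) \<le> covering_number S A + covering_number S B"
proof -
  obtain T where T: "finite T" "card T = covering_number S A" "A \<subseteq> T + S"
    using covering_number_attained[OF assms(1)] .
  obtain U where U: "finite U" "card U = covering_number S B" "B \<subseteq> U + S"
    using covering_number_attained[OF assms(2)] .
  have "covering_number S (A \<union> B) \<le> card (T \<union> U)"
    using T U by (intro covering_number_le) (auto simp: Un_set_plus)
  also have "\<dots> \<le> card T + card U"
    by (rule card_Un_le)
  finally show ?thesis using T(2) U(2) by simp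
qed

lemma card_le_covering_number_mult_card:
  assumes "finitely_covers S A" "finite S"
  shows "card A \<le> covering_number S A * card S"
proof -
  obtain T where T: "finite T" "card T = covering_number S A" "A \<subseteq> T + S"
    using covering_number_attained[OF assms(1)] .
  have "card A \<le> card (T + S)"
    using T assms(2) by (intro card_mono finite_set_plus)
  also have "\<dots> \<le> card (T \<times> S)"
    unfolding set_plus_image using T(1) assms(2) by (intro card_image_le) simp
  also have "\<dots> = covering_number S A * card S"
    by (simp add: card_cartesian_product T(2))
  finally show ?thesis .
qed

lemma finite_imp_finitely_covers:
  fixes S :: "'a::group_add set"
  assumes "S \<noteq> {}" "finite A"
  shows "finitely_covers S A"
proof -
  obtain s where "s \<in> S" using assms(1) by blast
  then have "a \<in> (\<lambda>a. a - s) ` A + S" if "a \<in> A" for a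
    using that set_plus_intro[of "a - s" "(\<lambda>a. a - s) ` A" s S] by simp
  then show ?thesis
    using assms(2) unfolding finitely_covers_def by blast
qed

lemma bounded_imp_finitely_covers:
  fixes S :: "'a::{real_normed_vector, heine_borel} set"
  assumes "interior S \<noteq> {}" "bounded A"
  shows "finitely_covers S A"
proof -
  obtain s where s: "s \<in> interior S" using assms(1) by blast
  have "closure A \<subseteq> (\<Union>t. (+) t ` interior S)"
  proof
    fix a
    have "a = (a - s) + s" by simp
    then show "a \<in> (\<Union>t. (+) t ` interior S)" using s by blast
  qed
  moreover have "compact (closure A)"
    using assms(2) by simp
  moreover have "open ((+) t ` interior S)" for t
    by (intro open_translation open_interior)
  ultimately obtain T where T: "finite T" "closure A \<subseteq> (\<Union>t\<in>T. (+) t ` interior S)"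
    by (metis compactE_image)
  have "A \<subseteq> (\<Union>t\<in>T. (+) t ` interior S)"
    using T(2) closure_subset by blast
  also have "\<dots> \<subseteq> T + S"
    using interior_subset by blast
  finally show ?thesis using T(1) by (auto simp: finitely_covers_def)
qed

subsection \<open>Covering density and efficiency of sets of reals\<close>

lemma mono_subadditive_tau_real:
  assumes "interior S \<noteq> {}"
  shows "mono_subadditive (\<lambda>x. real (tau_real S x))"
proof
  fix x y :: real
  have covers: "finitely_covers S {a..b}" for a b
    using assms by (intro bounded_imp_finitely_covers) auto
  show "real (tau_real S x) \<le> real (tau_real S y)" if "x \<le> y"
    unfolding tau_real_eq_covering_number of_nat_le_iff
    by (intro covering_number_mono covers) (use that in auto)
  show "real (tau_real S (x + y)) \<le> real (tau_real S x) + real (tau_real S y)"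
    if "0 \<le> x" "0 \<le> y"
  proof -
    have "{0..x + y} = {0..x} \<union> (x +o {0..y})"
      using that by (auto simp flip: set_minus_plus)
    then have "tau_real S (x + y) \<le> tau_real S x + covering_number S (x +o {0..y})"
      unfolding tau_real_eq_covering_number
      using covers by (metis covering_number_Un_le finitely_covers_translate)
    also have "covering_number S (x +o {0..y}) = tau_real S y"
      unfolding tau_real_eq_covering_number by (rule covering_number_translate[OF covers])
    finally show ?thesis by simp
  qed
qed

lemma tau_real_tendsto:
  assumes "interior S \<noteq> {}"
  shows "((\<lambda>x. real (tau_real S x) / x) \<longlongrightarrow> tau_R S) at_top"
proof -
  interpret mono_subadditive "\<lambda>x. real (tau_real S x)"
    using assms by (rule mono_subadditive_tau_real)
  show ?thesis
    unfolding tau_R_def using quotient_tendsto_INF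
    by (metis tendsto_Lim trivial_limit_at_top_linorder)
qed

lemma e_R_nonneg:
  assumes "interior S \<noteq> {}"
  shows "0 \<le> e_R S"
proof -
  have "0 \<le> tau_R S"
    by (rule tendsto_lowerbound[OF tau_real_tendsto[OF assms]])
      (auto intro: eventually_mono[OF eventually_gt_at_top[of 0]])
  then show ?thesis by (simp add: e_R_def)
qed

subsection \<open>Replacing integers by unit intervals\<close>

abbreviation unit_interval :: "int \<Rightarrow> real set" where
  "unit_interval s \<equiv> {real_of_int s..<real_of_int s + 1}"

text \<open>The preimage under \<open>floor\<close> is the Minkowski sum \<open>S + [0,1)\<close>.\<close>

definition thickening :: "int set \<Rightarrow> real set" where
  "thickening S = floor -` S"

lemma thickening_eq_UN: "thickening S = (\<Union>s\<in>S. unit_interval s)"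
  by (auto simp: thickening_def floor_eq_iff)

lemma interior_thickening_nonempty:
  assumes "S \<noteq> {}"
  shows "interior (thickening S) \<noteq> {}"
proof -
  obtain s where "s \<in> S" using assms by blast
  then have "interior (unit_interval s) \<subseteq> interior (thickening S)"
    by (intro interior_mono) (auto simp: thickening_eq_UN)
  then show ?thesis by auto
qed

lemma measure_thickening:
  assumes "finite S"
  shows "measure lebesgue (thickening S) = real (card S)"
proof -
  have "disjoint_family_on unit_interval S"
    by (auto simp: disjoint_family_on_def)
  then have "measure lebesgue (thickening S)
      = (\<Sum>s\<in>S. measure lebesgue (unit_interval s))"
    unfolding thickening_eq_UN using assms by (intro measure_finite_Union) auto
  then show ?thesis by simp
qed

lemma thickening_subset_of_int_plus_thickening:
  assumes "A \<subseteq> T + S"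
  shows "thickening A \<subseteq> real_of_int ` T + thickening S"
proof
  fix x assume "x \<in> thickening A"
  then have "\<lfloor>x\<rfloor> \<in> T + S" using assms by (auto simp: thickening_def)
  then obtain t s where ts: "t \<in> T" "s \<in> S" "\<lfloor>x\<rfloor> = t + s" by (rule set_plus_elim)
  then have "x - real_of_int t \<in> thickening S" by (simp add: thickening_def)
  then have "real_of_int t + (x - real_of_int t) \<in> real_of_int ` T + thickening S"
    using ts(1) by blast
  then show "x \<in> real_of_int ` T + thickening S" by simp
qed

lemma subset_ceiling_plus_if_thickening_subset:
  assumes "thickening A \<subseteq> T + thickening S"
  shows "A \<subseteq> ceiling ` T + S"
proof
  fix a assume "a \<in> A"
  then have "real_of_int a \<in> T + thickening S" using assms by (auto simp: thickening_def)
  then obtain t v where tv: "t \<in> T" "v \<in> thickening S" "real_of_int a = t + v"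
    by (rule set_plus_elim)
  have "\<lceil>t\<rceil> + \<lfloor>v\<rfloor> = a" using tv(3) by linarith
  then show "a \<in> ceiling ` T + S"
    using tv(1,2) by (auto simp: thickening_def)
qed

lemma covering_number_thickening:
  assumes "finitely_covers S A"
  shows "covering_number (thickening S) (thickening A) = covering_number S A"
proof (rule antisym)
  show "covering_number (thickening S) (thickening A) \<le> covering_number S A"
    using assms thickening_subset_of_int_plus_thickening
    by (rule covering_number_le_if_image_covers)
  have "finitely_covers (thickening S) (thickening A)"
    using assms thickening_subset_of_int_plus_thickening
    unfolding finitely_covers_def by blast
  then show "covering_number S A \<le> covering_number (thickening S) (thickening A)"
    using subset_ceiling_plus_if_thickening_subset
    by (rule covering_number_le_if_image_covers)
qed

lemma tau_int_eq_covering_number_thickening: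
  assumes "S \<noteq> {}"
  shows "tau_int S n = covering_number (thickening S) {0..<real n}"
proof -
  have "tau_int S n = covering_number (thickening S) (thickening {1..int n})"
    using assms unfolding tau_int_eq_covering_number
    by (simp add: covering_number_thickening finite_imp_finitely_covers)
  also have "thickening {1..int n} = 1 +o {0..<real n}"
    by (auto simp: thickening_def simp flip: set_minus_plus) linarith+
  also have "covering_number (thickening S) (1 +o {0..<real n})
      = covering_number (thickening S) {0..<real n}"
    using assms
    by (intro covering_number_translate bounded_imp_finitely_covers
        interior_thickening_nonempty) auto
  finally show ?thesis .
qed

lemma tau_int_tendsto_tau_R_thickening:
  assumes "S \<noteq> {}"
  shows "(\<lambda>n. real (tau_int S n) / real n) \<longlonglongrightarrow> tau_R (thickening S)"
proof -
  let ?\<tau> = "tau_real (thickening S)"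
  have covers: "finitely_covers (thickening S) A" if "bounded A" for A
    using assms that by (intro bounded_imp_finitely_covers interior_thickening_nonempty)
  have upper: "tau_int S n \<le> ?\<tau> (real n)" for n
    unfolding tau_int_eq_covering_number_thickening[OF assms] tau_real_eq_covering_number
    by (intro covering_number_mono covers) auto
  have lower: "?\<tau> (real n) \<le> tau_int S (Suc n)" for n
    unfolding tau_int_eq_covering_number_thickening[OF assms] tau_real_eq_covering_number
    by (intro covering_number_mono covers) auto
  have lim: "(\<lambda>n. real (?\<tau> (real n)) / real n) \<longlonglongrightarrow> tau_R (thickening S)"
    using tau_real_tendsto[OF interior_thickening_nonempty[OF assms]] filterlim_real_sequentially
    by (rule filterlim_compose)
  have "(\<lambda>n. real (tau_int S (Suc n)) / real (Suc n)) \<longlonglongrightarrow> tau_R (thickening S)"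
  proof (rule tendsto_sandwich)
    show "(\<lambda>n. real (?\<tau> (real n)) / real n * (real n / real (Suc n)))
        \<longlonglongrightarrow> tau_R (thickening S)"
      using tendsto_mult[OF lim LIMSEQ_n_over_Suc_n] by simp
    show "\<forall>\<^sub>F n in sequentially. real (?\<tau> (real n)) / real n * (real n / real (Suc n))
        \<le> real (tau_int S (Suc n)) / real (Suc n)"
      using eventually_gt_at_top[of 0]
      by eventually_elim (use lower in \<open>simp add: divide_right_mono\<close>)
    show "(\<lambda>n. real (?\<tau> (real (Suc n))) / real (Suc n)) \<longlonglongrightarrow> tau_R (thickening S)"
      using lim by (rule LIMSEQ_Suc)
    show "\<forall>\<^sub>F n in sequentially. real (tau_int S (Suc n)) / real (Suc n)
        \<le> real (?\<tau> (real (Suc n))) / real (Suc n)"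
      by (intro always_eventually allI divide_right_mono of_nat_mono upper of_nat_0_le_iff)
  qed
  then show ?thesis by (rule LIMSEQ_imp_Suc)
qed

lemma tau_Z_eq_tau_R_thickening:
  assumes "S \<noteq> {}"
  shows "tau_Z S = tau_R (thickening S)"
  unfolding tau_Z_def using tau_int_tendsto_tau_R_thickening[OF assms] by (rule limI)

lemma e_Z_eq_e_R_thickening:
  assumes "finite S" "S \<noteq> {}"
  shows "e_Z S = e_R (thickening S)"
  using assms by (simp add: e_Z_def e_R_def tau_Z_eq_tau_R_thickening measure_thickening)

lemma e_Z_le_1:
  assumes "finite S" "S \<noteq> {}"
  shows "e_Z S \<le> 1"
proof -
  have "1 \<le> real (tau_int S n) / real n * real (card S)" if "0 < n" for n
  proof -
    have "card {1..int n} \<le> tau_int S n * card S"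
      unfolding tau_int_eq_covering_number using assms
      by (intro card_le_covering_number_mult_card finite_imp_finitely_covers) auto
    then have "real n \<le> real (tau_int S n) * real (card S)"
      by (simp flip: of_nat_mult)
    then show ?thesis using that by (simp add: field_simps)
  qed
  then have "\<forall>\<^sub>F n in sequentially. 1 \<le> real (tau_int S n) / real n * real (card S)"
    by (rule eventually_mono[OF eventually_gt_at_top])
  moreover have "(\<lambda>n. real (tau_int S n) / real n * real (card S))
      \<longlonglongrightarrow> tau_Z S * real (card S)"
    unfolding tau_Z_eq_tau_R_thickening[OF assms(2)]
    by (rule tendsto_mult_right[OF tau_int_tendsto_tau_R_thickening[OF assms(2)]])
  ultimately have "1 \<le> tau_Z S * real (card S)"
    by (intro tendsto_lowerbound) auto
  then show ?thesis by (simp add: e_Z_def)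
qed

subsection \<open>Comparison of the infima\<close>

definition interval_families :: "nat \<Rightarrow> (nat \<Rightarrow> real set) set" where
  "interval_families k = {I. \<forall>i\<in>{1..k}. bounded_pos_interval (I i)}"

definition equal_length_families :: "nat \<Rightarrow> (nat \<Rightarrow> real set) set" where
  "equal_length_families k = {I \<in> interval_families k.
     \<forall>i\<in>{1..k}. \<forall>j\<in>{1..k}. measure lebesgue (I i) = measure lebesgue (I j)}"

lemma beta_eq_INF: "beta k = (INF I\<in>interval_families k. e_R (\<Union>i\<in>{1..k}. I i))"
  by (simp add: beta_def interval_families_def image_Collect)

lemma gamma_eq_INF: "gamma k = (INF I\<in>equal_length_families k. e_R (\<Union>i\<in>{1..k}. I i))"
  by (simp add: gamma_def equal_length_families_def interval_families_def image_Collect)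

lemma alpha_eq_INF: "alpha k = (INF S\<in>{S. finite S \<and> card S = k}. e_Z S)"
  by (simp add: alpha_def image_Collect)

lemma bounded_pos_interval_imp_interior_nonempty:
  assumes "bounded_pos_interval I"
  shows "interior I \<noteq> {}"
proof -
  have "convex I" "\<not> negligible I"
    using assms negligible_imp_measure0[of I]
    by (auto simp: bounded_pos_interval_def is_interval_convex_1)
  then show ?thesis by (simp add: negligible_convex_interior)
qed

lemma bdd_below_e_R_interval_families:
  assumes "1 \<le> k"
  shows "bdd_below ((\<lambda>I. e_R (\<Union>i\<in>{1..k}. I i)) ` interval_families k)"
proof (rule bdd_belowI2)
  fix I assume "I \<in> interval_families k"
  then have "interior (I 1) \<noteq> {}"
    using assms
    by (intro bounded_pos_interval_imp_interior_nonempty) (simp add: interval_families_def)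
  moreover have "interior (I 1) \<subseteq> interior (\<Union>i\<in>{1..k}. I i)"
    using assms by (intro interior_mono) force
  ultimately show "0 \<le> e_R (\<Union>i\<in>{1..k}. I i)"
    by (intro e_R_nonneg) blast
qed

lemma thickening_as_equal_length_family:
  assumes "finite S"
  obtains I where "I \<in> equal_length_families (card S)" "(\<Union>i\<in>{1..card S}. I i) = thickening S"
proof -
  obtain h where h: "bij_betw h {1..card S} S"
    using ex_bij_betw_nat_finite_1[OF assms] by blast
  define I where "I i = unit_interval (h i)" for i
  have "bounded_pos_interval (I i)" "measure lebesgue (I i) = 1" for i
    by (auto simp: bounded_pos_interval_def I_def is_interval_co)
  then have "I \<in> equal_length_families (card S)"
    by (simp add: equal_length_families_def interval_families_def)
  moreover have "(\<Union>i\<in>{1..card S}. I i) = (\<Union>s\<in>h ` {1..card S}. unit_interval s)"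
    by (simp add: I_def)
  then have "(\<Union>i\<in>{1..card S}. I i) = thickening S"
    by (simp only: bij_betw_imp_surj_on[OF h] thickening_eq_UN)
  ultimately show thesis by (rule that)
qed

lemma beta_le_gamma:
  assumes "1 \<le> k"
  shows "beta k \<le> gamma k"
  unfolding beta_eq_INF gamma_eq_INF
proof (rule cINF_superset_mono)
  show "equal_length_families k \<noteq> {}"
    using thickening_as_equal_length_family[of "{1..int k}"] by auto
qed (use bdd_below_e_R_interval_families[OF assms] in \<open>auto simp: equal_length_families_def\<close>)

lemma gamma_le_e_Z:
  assumes "finite S" "S \<noteq> {}"
  shows "gamma (card S) \<le> e_Z S"
proof -
  obtain I where I: "I \<in> equal_length_families (card S)" "(\<Union>i\<in>{1..card S}. I i) = thickening S"
    using thickening_as_equal_length_family[OF assms(1)] .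
  have "1 \<le> card S"
    using assms by (simp add: Suc_le_eq card_gt_0_iff)
  then have "bdd_below ((\<lambda>I. e_R (\<Union>i\<in>{1..card S}. I i)) ` equal_length_families (card S))"
    by (rule bdd_below_mono[OF bdd_below_e_R_interval_families])
      (auto simp: equal_length_families_def)
  then have "gamma (card S) \<le> e_R (\<Union>i\<in>{1..card S}. I i)"
    unfolding gamma_eq_INF using I(1) by (rule cINF_lower)
  then show ?thesis by (simp only: I(2) e_Z_eq_e_R_thickening[OF assms])
qed

lemma gamma_le_alpha:
  assumes "1 \<le> k"
  shows "gamma k \<le> alpha k"
  unfolding alpha_eq_INF
proof (rule cINF_greatest)
  have "card {1..int k} = k" by simp
  then show "{S :: int set. finite S \<and> card S = k} \<noteq> {}" by blast
qed (use assms gamma_le_e_Z in fastforce)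

lemma alpha_le_1:
  assumes "1 \<le> k"
  shows "alpha k \<le> 1"
proof -
  have "alpha k \<le> e_Z {1..int k}"
    unfolding alpha_eq_INF
  proof (rule cINF_lower)
    show "bdd_below (e_Z ` {S. finite S \<and> card S = k})"
      using gamma_le_e_Z assms by (intro bdd_belowI2[of _ "gamma k"]) fastforce
  qed simp
  also have "\<dots> \<le> 1"
    using assms by (intro e_Z_le_1) auto
  finally show ?thesis .
qed

theorem theorem8p1:
  fixes k :: nat
  assumes "k \<ge> 1"
  shows "beta k \<le> gamma k \<and> gamma k \<le> alpha k \<and> alpha k \<le> 1"
  using beta_le_gamma[OF assms] gamma_le_alpha[OF assms] alpha_le_1[OF assms] by blast

end
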